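(* Let $n\geq 1$ and $k\geq 0$ be integers. Let $G_n=\{\sigma\in\mathbb{S}_n\mid \sigma\cdot 1^n=1^n\}$, let $\tilde{\mathfrak{F}}(1^n,1^n)\in\mathbb{Z}[a,b]$ be the polynomial defined in the context (with $e=1$), and let $\tilde{\mathfrak{F}}_k(1^n,1^n)\in\mathbb{Z}[a]$ be its coefficient of $b^k$. Then $$\tilde{\mathfrak{F}}_k(1^n,1^n)=\sum_{w\in G_n,\ \mathrm{tl}(w)=k}a^{\,k-[3k-\mathrm{sl}(w)]/2}=\sum_{i\geq 0}\mathcal{E}^n_{k,2i+k}\,a^i .$$
   Context: Let $N=\{1,2\}$ and write elements of $N^n$ as words. The symmetric group $\mathbb{S}_n$, with simple transpositions $s_1,\dots,s_{n-1}$, acts on $N^n$ (left action): $s_i$ changes only the letters in positions $i,i+1$, by the rule $11\mapsto 22$, $22\mapsto 11$, $12\mapsto 12$, $21\mapsto 21$. The word $1^n$ is $1\cdots1$ ($n$ letters). The stabilizer $G_n=\{\sigma\in\mathbb{S}_n\mid\sigma\cdot 1^n=1^n\}$ is generated by $t_i=s_is_{i+1}s_i$, $1\leq i\leq n-2$. For $w\in G_n$, $\mathrm{tl}(w)$ is the minimal length of an expression of $w$ as a product of the $t_i$'s, and $\mathrm{sl}(w)$ is the minimal length of an expression of $w$ as a product of the $s_i$'s. Set $\mathcal{E}^n_{k,s}=\#\{\sigma\in G_n\mid \mathrm{tl}(\sigma)=k,\ \mathrm{sl}(\sigma)=s\}$. Treat $a,b$ as indeterminates and let $V$ be free with basis $v_1,v_2$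 and braiding $c(v_1\otimes v_1)=a\,v_2\otimes v_2$, $c(v_1\otimes v_2)=b\,v_1\otimes v_2$, $c(v_2\otimes v_1)=b\,v_2\otimes v_1$, $c(v_2\otimes v_2)=v_1\otimes v_1$ (the parameter $e$ of the general braiding is set to $1$). Let $c_i$ be $c$ acting on factors $i,i+1$ of $V^{\otimes n}$. For $\sigma\in\mathbb{S}_n$ with reduced expression $\sigma=s_{i_1}\cdots s_{i_l}$ put $\Phi_\sigma=c_{i_1}\cdots c_{i_l}$ (independent of the reduced expression). Then $\tilde{\mathfrak{F}}(1^n,1^n)$ is defined by $\sum_{\sigma\in G_n}\Phi_\sigma(v_1^{\otimes n})=\tilde{\mathfrak{F}}(1^n,1^n)\,v_1^{\otimes n}$. *)

theory Defs
  imports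
    "HOL-Combinatorics.Permutations"
    "HOL-Computational_Algebra.Polynomial"
    "HOL-Library.Poly_Mapping"
    "HOL-Library.Groups_Big_Fun"
begin

text \<open>
  Permutations of \<open>{1..n}\<close> are multiplied by composition, and positions in a word are counted
  from 1, so the letter in position \<open>i\<close> of \<open>x\<close> is \<open>x ! (i - 1)\<close>.
\<close>

datatype letter = L1 | L2

definition words :: "nat \<Rightarrow> letter list set" where
  "words n = {x. length x = n}"

definition simple_transp :: "nat \<Rightarrow> nat \<Rightarrow> nat" where
  "simple_transp i = transpose i (i + 1)"

definition t_gen :: "nat \<Rightarrow> nat \<Rightarrow> nat" where
  "t_gen i = simple_transp i \<circ> simple_transp (i + 1) \<circ> simple_transp i"

definition gen_prod :: "(nat \<Rightarrow> nat \<Rightarrow> nat) \<Rightarrow> nat list \<Rightarrow> nat \<Rightarrow> nat" where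
  "gen_prod g is = foldr (\<lambda>i \<pi>. g i \<circ> \<pi>) is id"

definition is_s_expr :: "nat \<Rightarrow> (nat \<Rightarrow> nat) \<Rightarrow> nat list \<Rightarrow> bool" where
  "is_s_expr n \<sigma> is \<longleftrightarrow> (\<forall>i\<in>set is. 1 \<le> i \<and> i + 1 \<le> n) \<and> gen_prod simple_transp is = \<sigma>"

definition is_t_expr :: "nat \<Rightarrow> (nat \<Rightarrow> nat) \<Rightarrow> nat list \<Rightarrow> bool" where
  "is_t_expr n \<sigma> is \<longleftrightarrow> (\<forall>i\<in>set is. 1 \<le> i \<and> i + 2 \<le> n) \<and> gen_prod t_gen is = \<sigma>"

definition sl :: "nat \<Rightarrow> (nat \<Rightarrow> nat) \<Rightarrow> nat" where
  "sl n \<sigma> = (LEAST l. \<exists>is. is_s_expr n \<sigma> is \<and> length is = l)"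

definition tl_len :: "nat \<Rightarrow> (nat \<Rightarrow> nat) \<Rightarrow> nat" where
  "tl_len n \<sigma> = (LEAST l. \<exists>is. is_t_expr n \<sigma> is \<and> length is = l)"

definition is_reduced :: "nat \<Rightarrow> (nat \<Rightarrow> nat) \<Rightarrow> nat list \<Rightarrow> bool" where
  "is_reduced n \<sigma> is \<longleftrightarrow> is_s_expr n \<sigma> is \<and> length is = sl n \<sigma>"


section \<open>The action on words\<close>

fun flip :: "letter \<Rightarrow> letter \<Rightarrow> letter list" where
  "flip L1 L1 = [L2, L2]"
| "flip L2 L2 = [L1, L1]"
| "flip L1 L2 = [L1, L2]"
| "flip L2 L1 = [L2, L1]"

definition s_act :: "nat \<Rightarrow> letter list \<Rightarrow> letter list" where
  "s_act i x = take (i - 1) x @ flip (x ! (i - 1)) (x ! i) @ drop (i + 1) x"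

text \<open>
  The choice of expression is immaterial: see \<open>act_eq\<close> and \<open>act_comp\<close> below.
\<close>

definition act :: "nat \<Rightarrow> (nat \<Rightarrow> nat) \<Rightarrow> letter list \<Rightarrow> letter list" where
  "act n \<sigma> x = foldr s_act (SOME is. is_s_expr n \<sigma> is) x"

definition G :: "nat \<Rightarrow> (nat \<Rightarrow> nat) set" where
  "G n = {\<sigma>. \<sigma> permutes {1..n} \<and> act n \<sigma> (replicate n L1) = replicate n L1}"

definition E :: "nat \<Rightarrow> nat \<Rightarrow> nat \<Rightarrow> nat" where
  "E n k s = card {\<sigma> \<in> G n. tl_len n \<sigma> = k \<and> sl n \<sigma> = s}"


section \<open>The braided module\<close>

text \<open>
  \<open>\<int>[a,b]\<close> is rendered as \<open>\<int>[a][b]\<close>, that is, \<open>int poly poly\<close> with \<open>b\<close> the outer and \<open>a\<close> the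
  inner indeterminate.  The tensor algebra of \<open>V\<close> is the free module on all words;
  \<open>V\<^sup>\<otimes>\<^sup>n\<close> is the span of the words of length \<open>n\<close>, the word \<open>x\<close> standing for
  the tensor product of the \<open>v\<^bsub>x_i\<^esub>\<close>.
\<close>

type_synonym coeffs = "int poly poly"
type_synonym tensor = "letter list \<Rightarrow>\<^sub>0 coeffs"

definition var_a :: coeffs where "var_a = [:[:0, 1:]:]"
definition var_b :: coeffs where "var_b = [:0, 1:]"

definition vec :: "letter list \<Rightarrow> tensor" where
  "vec x = Poly_Mapping.single x 1"

definition scale :: "coeffs \<Rightarrow> tensor \<Rightarrow> tensor" where
  "scale r = Poly_Mapping.map ((*) r)"

definition lin_ext :: "(letter list \<Rightarrow> tensor) \<Rightarrow> tensor \<Rightarrow> tensor" where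
  "lin_ext f u = (\<Sum>x\<in>Poly_Mapping.keys u. scale (Poly_Mapping.lookup u x) (f x))"

fun braiding :: "letter \<Rightarrow> letter \<Rightarrow> tensor" where
  "braiding L1 L1 = scale var_a (vec [L2, L2])"
| "braiding L1 L2 = scale var_b (vec [L1, L2])"
| "braiding L2 L1 = scale var_b (vec [L2, L1])"
| "braiding L2 L2 = vec [L1, L1]"

definition c_op :: "nat \<Rightarrow> tensor \<Rightarrow> tensor" where
  "c_op i = lin_ext (\<lambda>x. lin_ext (\<lambda>y. vec (take (i - 1) x @ y @ drop (i + 1) x))
                                (braiding (x ! (i - 1)) (x ! i)))"

definition Phi :: "nat \<Rightarrow> (nat \<Rightarrow> nat) \<Rightarrow> tensor \<Rightarrow> tensor" where
  "Phi n \<sigma> = foldr c_op (SOME is. is_reduced n \<sigma> is)"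

definition Ftilde :: "nat \<Rightarrow> coeffs" where
  "Ftilde n = (THE F. (\<Sum>\<sigma>\<in>G n. Phi n \<sigma> (vec (replicate n L1))) = scale F (vec (replicate n L1)))"

definition Ftilde_k :: "nat \<Rightarrow> nat \<Rightarrow> int poly" where
  "Ftilde_k n k = coeff (Ftilde n) k"


section \<open>The action is well defined\<close>

text \<open>
  Recording at each position whether the letter agrees with the alternating pattern turns the
  action into the permutation of places.
\<close>

definition place :: "letter list \<Rightarrow> nat \<Rightarrow> bool" where
  "place x j \<longleftrightarrow> (x ! (j - 1) = L1) = even j"

lemma length_flip [simp]: "length (flip p q) = 2"
  by (cases p; cases q) auto

lemma length_s_act: "1 \<le> i \<Longrightarrow> i + 1 \<le> length x \<Longrightarrow> length (s_act i x) = length x"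
  by (auto simp: s_act_def)

lemma length_foldr_s_act:
  "(\<forall>i\<in>set is. 1 \<le> i \<and> i + 1 \<le> length x) \<Longrightarrow> length (foldr s_act is x) = length x"
  by (induction "is") (auto simp: length_s_act)

lemma place_s_act:
  assumes "1 \<le> i" "i + 1 \<le> length x" "1 \<le> j" "j \<le> length x"
  shows "place (s_act i x) j = place x (simple_transp i j)"
proof -
  obtain m where m: "i = Suc m" using assms by (cases i) auto
  obtain l where l: "j = Suc l" using assms by (cases j) auto
  consider "l < m" | "l = m" | "l = Suc m" | "l > Suc m" by linarith
  then show ?thesis
  proof cases
    case 1
    then show ?thesis using assms
      by (auto simp: place_def s_act_def m l simple_transp_def transpose_def nth_append)
  next
    case 2
    then show ?thesis using assms
      by (cases "x ! m"; cases "x ! Suc m")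
         (auto simp: place_def s_act_def m l simple_transp_def transpose_def nth_append)
  next
    case 3
    then show ?thesis using assms
      by (cases "x ! m"; cases "x ! Suc m")
         (auto simp: place_def s_act_def m l simple_transp_def transpose_def nth_append)
  next
    case 4
    then have "Suc (Suc m) + (l - m - 2) = l" by simp
    with 4 show ?thesis using assms
      by (auto simp: place_def s_act_def m l simple_transp_def transpose_def nth_append)
  qed
qed

lemma gen_prod_simps [simp]:
  "gen_prod g [] = id" "gen_prod g (i # is) = g i \<circ> gen_prod g is"
  by (simp_all add: gen_prod_def)

lemma gen_prod_append: "gen_prod g (is @ js) = gen_prod g is \<circ> gen_prod g js"
  by (induction "is") (auto simp: comp_assoc)

lemma simple_transp_permutes: "1 \<le> i \<Longrightarrow> i + 1 \<le> n \<Longrightarrow> simple_transp i permutes {1..n}"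
  unfolding simple_transp_def by (rule permutes_swap_id) auto

lemma s_expr_permutes: "is_s_expr n \<sigma> is \<Longrightarrow> \<sigma> permutes {1..n}"
proof (induction "is" arbitrary: \<sigma>)
  case Nil
  then show ?case by (auto simp: is_s_expr_def permutes_id simp del: id_apply)
next
  case (Cons i "is")
  then show ?case
    using permutes_compose[OF _ simple_transp_permutes] by (auto simp: is_s_expr_def)
qed

lemma place_foldr:
  assumes "is_s_expr (length x) \<sigma> is" "1 \<le> j" "j \<le> length x"
  shows "place (foldr s_act is x) (\<sigma> j) = place x j"
  using assms
proof (induction "is" arbitrary: \<sigma>)
  case Nil
  then show ?case by (auto simp: is_s_expr_def)
next
  case (Cons i "is")
  let ?\<tau> = "gen_prod simple_transp is"
  have e: "is_s_expr (length x) ?\<tau> is" and i: "1 \<le> i" "i + 1 \<le> length x"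
    and \<sigma>: "\<sigma> = simple_transp i \<circ> ?\<tau>"
    using Cons.prems by (auto simp: is_s_expr_def)
  have len: "length (foldr s_act is x) = length x"
    using e by (intro length_foldr_s_act) (auto simp: is_s_expr_def)
  have "\<sigma> j \<in> {1..length x}"
    using permutes_in_image[OF s_expr_permutes[OF Cons.prems(1)]] Cons.prems(2,3) by auto
  then have "place (s_act i (foldr s_act is x)) (\<sigma> j)
      = place (foldr s_act is x) (simple_transp i (\<sigma> j))"
    using i len by (intro place_s_act) auto
  also have "simple_transp i (\<sigma> j) = ?\<tau> j"
    by (simp add: \<sigma> simple_transp_def)
  finally show ?case using Cons.IH[OF e Cons.prems(2,3)] by simp
qed

lemma place_inject:
  assumes "length x = length y" "\<And>j. 1 \<le> j \<Longrightarrow> j \<le> length x \<Longrightarrow> place x j = place y j"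
  shows "x = y"
proof (rule nth_equalityI[OF assms(1)])
  fix i assume "i < length x"
  then have "place x (Suc i) = place y (Suc i)" by (intro assms(2)) auto
  then show "x ! i = y ! i" by (cases "x ! i"; cases "y ! i") (auto simp: place_def)
qed

lemma foldr_s_act_unique:
  assumes "is_s_expr (length x) \<sigma> is" "is_s_expr (length x) \<sigma> js"
  shows "foldr s_act is x = foldr s_act js x"
proof (rule place_inject)
  have l: "length (foldr s_act ks x) = length x" if "is_s_expr (length x) \<sigma> ks" for ks
    using that by (intro length_foldr_s_act) (auto simp: is_s_expr_def)
  show "length (foldr s_act is x) = length (foldr s_act js x)"
    using assms by (simp add: l)
  fix j assume j: "1 \<le> j" "j \<le> length (foldr s_act is x)"
  have "j \<in> \<sigma> ` {1..length x}"
    unfolding permutes_image[OF s_expr_permutes[OF assms(1)]] using j assms by (auto simp: l)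
  then obtain i where "j = \<sigma> i" "1 \<le> i" "i \<le> length x" by auto
  then show "place (foldr s_act is x) j = place (foldr s_act js x) j"
    using assms by (simp add: place_foldr)
qed

lemma transpose_s_expr:
  assumes "1 \<le> i" "i \<le> j" "j \<le> n"
  shows "\<exists>is. is_s_expr n (transpose i j) is"
  using assms(2,3)
proof (induction j rule: dec_induct)
  case base
  show ?case by (intro exI[of _ "[]"]) (simp add: is_s_expr_def fun_eq_iff)
next
  case (step j)
  then obtain "is" where "is": "is_s_expr n (transpose i j) is" by auto
  show ?case
  proof (cases "i = j")
    case True
    with step assms(1) show ?thesis
      by (intro exI[of _ "[j]"]) (auto simp: is_s_expr_def simple_transp_def)
  next
    case False
    have "transpose i (Suc j) = simple_transp j \<circ> transpose i j \<circ> simple_transp j"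
      using False step(1) by (auto simp: simple_transp_def transpose_def fun_eq_iff)
    with "is" step assms(1) show ?thesis
      by (intro exI[of _ "[j] @ is @ [j]"])
         (auto simp: is_s_expr_def gen_prod_append comp_assoc)
  qed
qed

lemma s_expr_exists:
  assumes "\<sigma> permutes {1..n}"
  shows "\<exists>is. is_s_expr n \<sigma> is"
  using assms finite_atLeastAtMost[of 1 n]
proof (induction rule: permutes_induct)
  case id
  show ?case by (intro exI[of _ "[]"]) (simp add: is_s_expr_def fun_eq_iff)
next
  case (swap a b p)
  obtain "is" where "is": "is_s_expr n p is" using swap by auto
  have "\<exists>js. is_s_expr n (transpose a b) js"
    using transpose_s_expr[of a b n] transpose_s_expr[of b a n] swap(1,2)
    by (cases "a \<le> b") (auto simp: transpose_commute)
  then obtain js where "is_s_expr n (transpose a b) js" ..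
  with "is" show ?case
    by (intro exI[of _ "js @ is"]) (auto simp: is_s_expr_def gen_prod_append)
qed

lemma act_eq:
  assumes "is_s_expr n \<sigma> is" "x \<in> words n"
  shows "act n \<sigma> x = foldr s_act is x"
  using foldr_s_act_unique[of x \<sigma> "SOME is. is_s_expr n \<sigma> is" "is"] someI[of "is_s_expr n \<sigma>", OF assms(1)]
    assms by (simp add: act_def words_def)

lemma act_simple_transp:
  assumes "1 \<le> i" "i + 1 \<le> n" "x \<in> words n"
  shows "act n (simple_transp i) x = s_act i x"
  using act_eq[of n "simple_transp i" "[i]" x] assms by (simp add: is_s_expr_def)

lemma act_comp:
  assumes "\<sigma> permutes {1..n}" "\<tau> permutes {1..n}" "x \<in> words n"
  shows "act n (\<sigma> \<circ> \<tau>) x = act n \<sigma> (act n \<tau> x)"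
proof -
  obtain "is" js where e: "is_s_expr n \<sigma> is" "is_s_expr n \<tau> js"
    using s_expr_exists assms by blast
  have "is_s_expr n (\<sigma> \<circ> \<tau>) (is @ js)"
    using e by (auto simp: is_s_expr_def gen_prod_append)
  moreover have "foldr s_act js x \<in> words n"
    using e(2) assms(3) length_foldr_s_act[of js x] by (auto simp: words_def is_s_expr_def)
  ultimately show ?thesis using e assms(3) by (simp add: act_eq)
qed

end

theory Submission
  imports Defs
begin

text \<open>
  Both length functions count inversions, and \<open>\<Phi>\<^sub>\<sigma>\<close> counts the same inversions with weights.

  The function \<^const>\<open>place\<close> turns the action on words into the permutation of places, and
  \<open>1\<^sup>n\<close> becomes the alternating pattern.  Hence elements of \<open>G\<^sub>n\<close> preserve the parity of
  positions: they permute the odd and the even positions separately.  As \<open>t\<^sub>i\<close> is the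
  transposition of \<open>i\<close> and \<open>i + 2\<close>, these generators act on each of the two classes as its
  adjacent transpositions.  So \<open>sl\<close> is the number of all inversions, and \<open>tl\<close> is the number of
  inversions between positions of equal parity.  Both are instances of one statement about
  the transpositions of \<open>i\<close> and \<open>i + d\<close> (\<open>Least_expr_length\<close>), for \<open>d = 1\<close> and \<open>d = 2\<close>.

  Now follow \<open>v\<^sub>1 \<otimes> \<dots> \<otimes> v\<^sub>1\<close> along a reduced expression of \<open>\<sigma>\<close>.  Every step creates exactly one
  inversion.  If the two positions that cross have equal parity, their current letters differ
  and the step contributes a factor \<open>b\<close>; otherwise the letters agree and the step is
  \<open>11 \<mapsto> 22\<close> with factor \<open>a\<close> or \<open>22 \<mapsto> 11\<close> with factor \<open>1\<close>.  Thus the exponent of \<open>b\<close> is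
  \<open>tl \<sigma>\<close>.  If \<open>\<sigma>\<close> fixes \<open>1\<^sup>n\<close>, the two kinds of flips are equally frequent, because
  the number of letters 2 is zero at both ends; so the exponent of \<open>a\<close> is half of
  \<open>sl \<sigma> - tl \<sigma>\<close> (\<open>Phi_stabilizer\<close>).  Summing over \<open>G\<^sub>n\<close> and grouping the terms by their exponents
  gives both equalities.
\<close>

section \<open>Inversions within residue classes\<close>

definition inversions :: "nat \<Rightarrow> nat \<Rightarrow> (nat \<Rightarrow> nat) \<Rightarrow> (nat \<times> nat) set" where
  "inversions d n \<sigma> = {(p, q). 1 \<le> p \<and> p < q \<and> q \<le> n \<and> p mod d = q mod d \<and> \<sigma> q < \<sigma> p}"

definition residue_perm :: "nat \<Rightarrow> nat \<Rightarrow> (nat \<Rightarrow> nat) \<Rightarrow> bool" where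
  "residue_perm d n \<sigma> \<longleftrightarrow> \<sigma> permutes {1..n} \<and> (\<forall>p. \<sigma> p mod d = p mod d)"

lemma finite_inversions [simp]: "finite (inversions d n \<sigma>)"
  by (rule finite_subset[of _ "{1..n} \<times> {1..n}"]) (auto simp: inversions_def)

lemma inversions_id [simp]: "inversions d n id = {}"
  by (auto simp: inversions_def)

lemma residue_perm_id [simp]: "residue_perm d n id"
  by (simp add: residue_perm_def permutes_id)

lemma residue_perm_transpose_comp:
  assumes "residue_perm d n \<tau>" "1 \<le> i" "i + d \<le> n"
  shows "residue_perm d n (transpose i (i + d) \<circ> \<tau>)"
proof -
  have "transpose i (i + d) permutes {1..n}"
    using assms by (intro permutes_swap_id) auto
  moreover have "transpose i (i + d) x mod d = x mod d" for x
    by (auto simp: transpose_def)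
  ultimately show ?thesis
    using assms(1) by (auto simp: residue_perm_def intro: permutes_compose)
qed

lemma residue_perm_gen_prod:
  assumes "\<forall>i\<in>set is. 1 \<le> i \<and> i + d \<le> n"
  shows "residue_perm d n (gen_prod (\<lambda>i. transpose i (i + d)) is)"
  using assms by (induction "is") (auto intro: residue_perm_transpose_comp simp del: id_apply)

text \<open>
  The values \<open>i\<close> and \<open>i + d\<close> are neighbours in their residue class, so exchanging them
  changes the relative order of no other pair of values in one class.
\<close>

lemma inversions_transpose_comp:
  assumes \<tau>: "residue_perm d n \<tau>" and d: "1 \<le> d" and i: "1 \<le> i" "i + d \<le> n"
    and pq: "\<tau> p = i" "\<tau> q = i + d" "p < q"
  shows "inversions d n (transpose i (i + d) \<circ> \<tau>) = insert (p, q) (inversions d n \<tau>)"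
    and "(p, q) \<notin> inversions d n \<tau>"
proof -
  have perm: "\<tau> permutes {1..n}" and res: "\<And>x. \<tau> x mod d = x mod d"
    using \<tau> by (auto simp: residue_perm_def)
  have inj: "\<tau> x = \<tau> y \<longleftrightarrow> x = y" for x y
    using permutes_inj[OF perm] by (auto dest: injD)
  have range: "p \<in> {1..n}" "q \<in> {1..n}"
    using permutes_in_image[OF perm, of p] permutes_in_image[OF perm, of q] i pq by auto
  have pq_res: "p mod d = q mod d"
    using res[of p] res[of q] pq by simp
  have gap: "v \<ge> u + d" if "u mod d = v mod d" "u < v" for u v
  proof -
    have "d dvd v - u" using that by (metis mod_eq_dvd_iff_nat less_imp_le)
    then have "d \<le> v - u" using that(2) by (intro dvd_imp_le) auto
    then show ?thesis using that(2) by linarith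
  qed
  have key: "transpose i (i + d) (\<tau> y) < transpose i (i + d) (\<tau> x)
      \<longleftrightarrow> (x, y) = (p, q) \<or> \<tau> y < \<tau> x"
    if "x < y" "x mod d = y mod d" for x y
  proof -
    have r: "\<tau> x mod d = \<tau> y mod d" using that res by simp
    have ne: "\<tau> x \<noteq> \<tau> y" using that inj by auto
    have xy: "x = p \<longleftrightarrow> \<tau> x = i" "x = q \<longleftrightarrow> \<tau> x = i + d"
             "y = p \<longleftrightarrow> \<tau> y = i" "y = q \<longleftrightarrow> \<tau> y = i + d"
      using inj pq by metis+
    have nr: "\<not> (\<tau> x = i + d \<and> \<tau> y = i)" using xy that(1) pq(3) by auto
    consider "\<tau> x + d \<le> \<tau> y" | "\<tau> y + d \<le> \<tau> x"
      using gap[OF r] gap[OF r[symmetric]] ne by linarith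
    then show ?thesis
      using nr d xy by cases (auto simp: transpose_def)
  qed
  show "inversions d n (transpose i (i + d) \<circ> \<tau>) = insert (p, q) (inversions d n \<tau>)"
    using key range pq pq_res by (auto simp: inversions_def)
  show "(p, q) \<notin> inversions d n \<tau>"
    using pq d by (auto simp: inversions_def)
qed

text \<open>
  The second case is the first one applied to the product, since the transposition is an
  involution.
\<close>

lemma inversions_transpose_comp_cases:
  assumes \<tau>: "residue_perm d n \<tau>" and d: "1 \<le> d" and i: "1 \<le> i" "i + d \<le> n"
  obtains (up) p q where "\<tau> p = i" "\<tau> q = i + d" "p < q" "(p, q) \<notin> inversions d n \<tau>"
      "inversions d n (transpose i (i + d) \<circ> \<tau>) = insert (p, q) (inversions d n \<tau>)"
    | (down) p q where "\<tau> p = i" "\<tau> q = i + d" "q < p"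
      "card (inversions d n \<tau>) = Suc (card (inversions d n (transpose i (i + d) \<circ> \<tau>)))"
proof -
  have perm: "\<tau> permutes {1..n}" using \<tau> by (simp add: residue_perm_def)
  obtain p q where pq: "\<tau> p = i" "\<tau> q = i + d"
    using permutes_surj[OF perm] by (metis surjD)
  have "p \<noteq> q" using pq d by auto
  then consider "p < q" | "q < p" by linarith
  then show thesis
  proof cases
    case 1
    then show thesis using inversions_transpose_comp[OF \<tau> d i pq] pq by (intro up) auto
  next
    case 2
    let ?\<tau>' = "transpose i (i + d) \<circ> \<tau>"
    have "transpose i (i + d) \<circ> ?\<tau>' = \<tau>" by (simp add: fun_eq_iff)
    moreover have "?\<tau>' q = i" "?\<tau>' p = i + d" using pq by auto
    ultimately show thesis
      using inversions_transpose_comp[OF residue_perm_transpose_comp[OF \<tau> i] d i, of q p] 2 pq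
      by (intro down[of p q]) auto
  qed
qed

lemma card_inversions_transpose_comp_le:
  assumes "residue_perm d n \<tau>" "1 \<le> d" "1 \<le> i" "i + d \<le> n"
  shows "card (inversions d n (transpose i (i + d) \<circ> \<tau>)) \<le> Suc (card (inversions d n \<tau>))"
  using assms by (cases rule: inversions_transpose_comp_cases) auto

lemma card_inversions_gen_prod_le:
  assumes "\<forall>i\<in>set is. 1 \<le> i \<and> i + d \<le> n" "1 \<le> d"
  shows "card (inversions d n (gen_prod (\<lambda>i. transpose i (i + d)) is)) \<le> length is"
  using assms
proof (induction "is")
  case (Cons i "is")
  let ?\<tau> = "gen_prod (\<lambda>i. transpose i (i + d)) is"
  have "card (inversions d n (transpose i (i + d) \<circ> ?\<tau>)) \<le> Suc (card (inversions d n ?\<tau>))"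
    using Cons.prems by (intro card_inversions_transpose_comp_le residue_perm_gen_prod) auto
  also have "\<dots> \<le> Suc (length is)"
    using Cons by simp
  finally show ?case by (simp add: comp_def)
qed (simp del: id_apply)

text \<open>
  At the least moved position \<open>j\<close>, the value \<open>j\<close> occurs later and in the same class, whereas
  \<open>\<sigma> j > j\<close>: this is an inversion.
\<close>

lemma inversions_empty_imp_id:
  assumes \<sigma>: "residue_perm d n \<sigma>" and empty: "inversions d n \<sigma> = {}"
  shows "\<sigma> = id"
proof
  have perm: "\<sigma> permutes {1..n}" and res: "\<And>x. \<sigma> x mod d = x mod d"
    using \<sigma> by (auto simp: residue_perm_def)
  have inj: "\<sigma> x = \<sigma> y \<longleftrightarrow> x = y" for x y
    using permutes_inj[OF perm] by (auto dest: injD)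
  fix j
  have "\<sigma> j = j"
  proof (induction j rule: less_induct)
    case (less j)
    show ?case
    proof (rule ccontr)
      assume ne: "\<sigma> j \<noteq> j"
      obtain q where q: "\<sigma> q = j" using permutes_surj[OF perm] by (metis surjD)
      have "\<not> q < j" using less.IH[of q] q by auto
      then have "j < q" using ne q by (cases "j = q") auto
      moreover have "\<not> \<sigma> j < j" using less.IH[of "\<sigma> j"] inj ne by blast
      then have "j < \<sigma> j" using ne by simp
      moreover have "j \<in> {1..n}" using ne permutes_not_in[OF perm] by blast
      moreover from this have "q \<in> {1..n}" using permutes_in_image[OF perm, of q] q by simp
      ultimately have "(j, q) \<in> inversions d n \<sigma>"
        using q res[of q] by (auto simp: inversions_def)
      then show False using empty by simp
    qed
  qed
  then show "\<sigma> j = id j" by simp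
qed

text \<open>
  If no value \<open>i\<close> stands to the right of \<open>i + d\<close>, then the inverse of \<open>\<sigma>\<close> increases along
  every residue class.
\<close>

lemma inversions_nonempty_imp_descent:
  assumes \<sigma>: "residue_perm d n \<sigma>" and ne: "inversions d n \<sigma> \<noteq> {}"
  obtains i p q where "1 \<le> i" "i + d \<le> n" "\<sigma> p = i" "\<sigma> q = i + d" "q < p"
proof -
  have perm: "\<sigma> permutes {1..n}" and res: "\<And>x. \<sigma> x mod d = x mod d"
    using \<sigma> by (auto simp: residue_perm_def)
  have inv: "inv \<sigma> (\<sigma> x) = x" "\<sigma> (inv \<sigma> x) = x" for x
    using permutes_inverses[OF perm] by auto
  obtain p q where pq: "1 \<le> p" "p < q" "q \<le> n" "p mod d = q mod d" "\<sigma> q < \<sigma> p"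
    using ne by (auto simp: inversions_def)
  have range: "\<sigma> p \<in> {1..n}" "\<sigma> q \<in> {1..n}"
    using permutes_in_image[OF perm, of p] permutes_in_image[OF perm, of q] pq(1-3) by auto
  have "\<exists>i. 1 \<le> i \<and> i + d \<le> n \<and> inv \<sigma> (i + d) < inv \<sigma> i"
  proof (rule ccontr)
    assume neg: "\<not> ?thesis"
    have up: "inv \<sigma> u \<le> inv \<sigma> (u + m * d)" if "1 \<le> u" "u + m * d \<le> n" for u m
      using that
    proof (induction m)
      case (Suc m)
      have "inv \<sigma> u \<le> inv \<sigma> (u + m * d)" using Suc by simp
      also have "\<dots> \<le> inv \<sigma> (u + m * d + d)"
      proof (rule leI)
        show "\<not> inv \<sigma> (u + m * d + d) < inv \<sigma> (u + m * d)"
          using neg[simplified, rule_format, of "u + m * d"] Suc.prems by (simp add: add_ac)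
      qed
      finally show ?case by (simp add: add_ac)
    qed simp
    have "d dvd \<sigma> p - \<sigma> q"
      using mod_eq_dvd_iff_nat[of "\<sigma> q" "\<sigma> p" d] pq res by simp
    then obtain m where "\<sigma> p - \<sigma> q = d * m" ..
    then have "\<sigma> p = \<sigma> q + m * d" using pq(5) by (simp add: mult.commute)
    then have "inv \<sigma> (\<sigma> q) \<le> inv \<sigma> (\<sigma> p)" using up[of "\<sigma> q" m] range by auto
    then show False using inv pq by simp
  qed
  then show thesis using that inv by blast
qed

lemma expr_of_length_card_inversions:
  assumes "residue_perm d n \<sigma>" "1 \<le> d"
  shows "\<exists>is. (\<forall>i\<in>set is. 1 \<le> i \<and> i + d \<le> n)
           \<and> gen_prod (\<lambda>i. transpose i (i + d)) is = \<sigma> \<and> length is = card (inversions d n \<sigma>)"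
  using assms(1)
proof (induction "card (inversions d n \<sigma>)" arbitrary: \<sigma>)
  case 0
  then have "\<sigma> = id" by (intro inversions_empty_imp_id) auto
  then show ?case by (intro exI[of _ "[]"]) (simp del: id_apply)
next
  case (Suc l)
  then have "inversions d n \<sigma> \<noteq> {}" by auto
  then obtain i p q where i: "1 \<le> i" "i + d \<le> n" and pq: "\<sigma> p = i" "\<sigma> q = i + d" "q < p"
    using inversions_nonempty_imp_descent[OF Suc.prems] by metis
  let ?\<tau> = "transpose i (i + d) \<circ> \<sigma>"
  have inj: "\<sigma> x = \<sigma> y \<Longrightarrow> x = y" for x y
    using permutes_inj Suc.prems by (auto simp: residue_perm_def dest: injD)
  from Suc.prems assms(2) i have "card (inversions d n \<sigma>) = Suc (card (inversions d n ?\<tau>))"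
  proof (cases rule: inversions_transpose_comp_cases)
    case (up p' q')
    then have "p' = p" "q' = q" using inj pq by auto
    then show ?thesis using up pq by simp
  qed
  then obtain "is" where "is": "\<forall>i\<in>set is. 1 \<le> i \<and> i + d \<le> n"
      "gen_prod (\<lambda>i. transpose i (i + d)) is = ?\<tau>" "length is = l"
    using Suc.hyps(1)[of ?\<tau>] Suc.hyps(2) residue_perm_transpose_comp[OF Suc.prems i] by auto
  have "transpose i (i + d) \<circ> ?\<tau> = \<sigma>" by (simp add: fun_eq_iff)
  then show ?case using "is" i Suc.hyps(2) by (intro exI[of _ "i # is"]) auto
qed

lemma Least_expr_length:
  assumes "residue_perm d n \<sigma>" "1 \<le> d"
  shows "(LEAST l. \<exists>is. ((\<forall>i\<in>set is. 1 \<le> i \<and> i + d \<le> n)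
            \<and> gen_prod (\<lambda>i. transpose i (i + d)) is = \<sigma>) \<and> length is = l)
         = card (inversions d n \<sigma>)"
proof (rule Least_equality)
  show "\<exists>is. ((\<forall>i\<in>set is. 1 \<le> i \<and> i + d \<le> n)
            \<and> gen_prod (\<lambda>i. transpose i (i + d)) is = \<sigma>) \<and> length is = card (inversions d n \<sigma>)"
    using expr_of_length_card_inversions[OF assms] by auto
qed (use card_inversions_gen_prod_le assms(2) in auto)

section \<open>The two length functions\<close>

lemma simple_transp_eq: "simple_transp = (\<lambda>i. transpose i (i + 1))"
  by (simp add: simple_transp_def fun_eq_iff)

lemma t_gen_eq: "t_gen = (\<lambda>i. transpose i (i + 2))"
  by (auto simp: t_gen_def simple_transp_def transpose_def fun_eq_iff)

lemma sl_eq_card_inversions: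
  assumes "\<sigma> permutes {1..n}"
  shows "sl n \<sigma> = card (inversions 1 n \<sigma>)"
  using Least_expr_length[of 1 n \<sigma>] assms
  by (simp add: sl_def is_s_expr_def simple_transp_eq residue_perm_def)

lemma residue_perm_G:
  assumes "\<sigma> \<in> G n"
  shows "residue_perm 2 n \<sigma>"
proof -
  have perm: "\<sigma> permutes {1..n}" and fixed: "act n \<sigma> (replicate n L1) = replicate n L1"
    using assms by (auto simp: G_def)
  obtain "is" where e: "is_s_expr n \<sigma> is" using s_expr_exists[OF perm] ..
  have f: "foldr s_act is (replicate n L1) = replicate n L1"
    using act_eq[OF e, of "replicate n L1"] fixed by (simp add: words_def)
  have "even (\<sigma> p) = even p" for p
  proof (cases "p \<in> {1..n}")
    case True
    then have "\<sigma> p \<in> {1..n}" using permutes_in_image[OF perm] by blast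
    then show ?thesis
      using place_foldr[of "replicate n L1" \<sigma> "is" p] e f True by (auto simp: place_def)
  qed (use permutes_not_in[OF perm] in simp)
  then have "\<sigma> p mod 2 = p mod 2" for p
    by (metis mod2_eq_if)
  then show ?thesis using perm by (simp add: residue_perm_def)
qed

lemma tl_len_eq_card_inversions:
  assumes "\<sigma> \<in> G n"
  shows "tl_len n \<sigma> = card (inversions 2 n \<sigma>)"
  using Least_expr_length[OF residue_perm_G[OF assms]]
  by (simp add: tl_len_def is_t_expr_def t_gen_eq)

section \<open>The braiding along a reduced expression\<close>

lemma lookup_scale [simp]: "Poly_Mapping.lookup (scale r u) x = r * Poly_Mapping.lookup u x"
  by (simp add: scale_def Poly_Mapping.map.rep_eq when_def)

lemma scale_scale: "scale r (scale s u) = scale (r * s) u"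
  by (rule poly_mapping_eqI) (simp add: mult.assoc)

lemma scale_one [simp]: "scale 1 u = u"
  by (rule poly_mapping_eqI) simp

lemma scale_sum_left: "scale (\<Sum>i\<in>A. r i) u = (\<Sum>i\<in>A. scale (r i) u)"
  by (rule poly_mapping_eqI) (simp add: lookup_sum sum_distrib_right)

lemma scale_vec_inject: "scale r (vec x) = scale s (vec x) \<longleftrightarrow> r = s"
proof
  assume "scale r (vec x) = scale s (vec x)"
  then have "Poly_Mapping.lookup (scale r (vec x)) x = Poly_Mapping.lookup (scale s (vec x)) x"
    by simp
  then show "r = s" by (simp add: vec_def)
qed simp

lemma scale_vec: "scale r (vec x) = Poly_Mapping.single x r"
  by (rule poly_mapping_eqI) (simp add: vec_def lookup_single when_def)

lemma lin_ext_scale_vec: "lin_ext f (scale r (vec x)) = scale r (f x)"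
proof (cases "r = 0")
  case True
  have "scale 0 (f x) = 0" by (rule poly_mapping_eqI) simp
  then show ?thesis using True by (simp add: lin_ext_def scale_vec)
qed (simp add: lin_ext_def scale_vec)

definition weight :: "letter \<Rightarrow> letter \<Rightarrow> coeffs" where
  "weight p q = (if p \<noteq> q then var_b else if p = L1 then var_a else 1)"

lemma braiding_eq: "braiding p q = scale (weight p q) (vec (flip p q))"
  by (cases p; cases q) (auto simp: weight_def)

lemma c_op_scale_vec:
  "c_op i (scale r (vec x)) = scale (r * weight (x ! (i - 1)) (x ! i)) (vec (s_act i x))"
  by (simp add: c_op_def lin_ext_scale_vec braiding_eq scale_scale s_act_def)

text \<open>
  The letters in two adjacent positions differ exactly when their places agree, because the
  alternating pattern has different letters there.
\<close>

lemma adjacent_letters_differ_iff: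
  assumes "1 \<le> i"
  shows "x ! (i - 1) \<noteq> x ! i \<longleftrightarrow> place x i = place x (i + 1)"
  using assms by (cases "x ! (i - 1)"; cases "x ! i") (auto simp: place_def)

lemma count_s_act:
  assumes "1 \<le> i" "i + 1 \<le> length x"
  shows "count_list (s_act i x) L2 + count_list [x ! (i - 1), x ! i] L2
       = count_list x L2 + count_list (flip (x ! (i - 1)) (x ! i)) L2"
proof -
  have "x = take (i - 1) x @ [x ! (i - 1), x ! i] @ drop (i + 1) x"
    using assms id_take_nth_drop[of "i - 1" x] Cons_nth_drop_Suc[of i x] by simp
  then have "count_list x L2 = count_list (take (i - 1) x) L2
      + count_list [x ! (i - 1), x ! i] L2 + count_list (drop (i + 1) x) L2"
    by (metis (no_types, lifting) count_list_append add.assoc)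
  then show ?thesis by (simp add: s_act_def)
qed

lemma inversions_2: "inversions 2 n \<sigma> = {(p, q) \<in> inversions 1 n \<sigma>. even p = even q}"
  by (auto simp: inversions_def mod2_eq_if split: if_splits)

text \<open>
  The linear relation records the exponent \<open>\<alpha>\<close> of \<open>a\<close>: a step \<open>11 \<mapsto> 22\<close> adds 4 to both sides
  (length and two new letters 2), a step \<open>22 \<mapsto> 11\<close> adds 0 and a step with factor \<open>b\<close>
  adds 2.
\<close>

lemma foldr_c_op_reduced:
  assumes "\<forall>i\<in>set is. 1 \<le> i \<and> i + 1 \<le> n"
    and "length is = card (inversions 1 n (gen_prod simple_transp is))"
  shows "\<exists>\<alpha>. foldr c_op is (vec (replicate n L1))
             = scale (var_a ^ \<alpha> * var_b ^ card (inversions 2 n (gen_prod simple_transp is)))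
                 (vec (foldr s_act is (replicate n L1)))
           \<and> 4 * \<alpha> + 2 * card (inversions 2 n (gen_prod simple_transp is))
             = 2 * length is + count_list (foldr s_act is (replicate n L1)) L2"
  using assms
proof (induction "is")
  case Nil
  have "count_list (replicate n L1) L2 = 0" by (induction n) auto
  then show ?case by (intro exI[of _ 0]) (simp add: id_def[symmetric])
next
  case (Cons i "is")
  let ?\<tau> = "gen_prod simple_transp is" and ?x = "foldr s_act is (replicate n L1)"
  have i: "1 \<le> i" "i + 1 \<le> n" and e: "is_s_expr n ?\<tau> is"
    using Cons.prems(1) by (auto simp: is_s_expr_def)
  have perm: "?\<tau> permutes {1..n}" using s_expr_permutes[OF e] .
  have \<tau>: "residue_perm 1 n ?\<tau>" using perm by (simp add: residue_perm_def)
  have step: "gen_prod simple_transp (i # is) = transpose i (i + 1) \<circ> ?\<tau>"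
    by (simp add: simple_transp_def)
  have le: "card (inversions 1 n ?\<tau>) \<le> length is"
    using card_inversions_gen_prod_le[of "is" 1 n] Cons.prems(1) by (simp add: simple_transp_eq)
  have len: "Suc (length is) = card (inversions 1 n (transpose i (i + 1) \<circ> ?\<tau>))"
    using Cons.prems(2) unfolding step by (simp add: comp_def)
  \<comment> \<open>A descent is excluded: it would leave \<open>length is + 2\<close> inversions for \<open>is\<close> alone.\<close>
  from \<tau> le_refl i obtain p q where pq: "?\<tau> p = i" "?\<tau> q = i + 1" "(p, q) \<notin> inversions 1 n ?\<tau>"
      and ins: "inversions 1 n (transpose i (i + 1) \<circ> ?\<tau>) = insert (p, q) (inversions 1 n ?\<tau>)"
    by (cases rule: inversions_transpose_comp_cases) (use le len in auto)
  have "length is = card (inversions 1 n ?\<tau>)" using len ins pq(3) by simp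
  then obtain \<alpha> where
      \<alpha>: "foldr c_op is (vec (replicate n L1))
            = scale (var_a ^ \<alpha> * var_b ^ card (inversions 2 n ?\<tau>)) (vec ?x)"
      and rel: "4 * \<alpha> + 2 * card (inversions 2 n ?\<tau>) = 2 * length is + count_list ?x L2"
    using Cons.IH Cons.prems(1) by auto
  have range: "p \<in> {1..n}" "q \<in> {1..n}"
    using permutes_in_image[OF perm, of p] permutes_in_image[OF perm, of q] i pq by auto
  have places: "place ?x i = even p" "place ?x (i + 1) = even q"
    using place_foldr[of "replicate n L1" ?\<tau> "is" p] place_foldr[of "replicate n L1" ?\<tau> "is" q]
      e range pq by (auto simp: place_def)
  have differ: "?x ! (i - 1) \<noteq> ?x ! i \<longleftrightarrow> even p = even q"
    using adjacent_letters_differ_iff[OF i(1), of ?x] places by simp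
  have "length ?x = n" using length_foldr_s_act[of "is" "replicate n L1"] Cons.prems(1) by simp
  then have count: "count_list (s_act i ?x) L2 + count_list [?x ! (i - 1), ?x ! i] L2
       = count_list ?x L2 + count_list (flip (?x ! (i - 1)) (?x ! i)) L2"
    using i by (intro count_s_act) auto
  have inv2: "inversions 2 n (transpose i (i + 1) \<circ> ?\<tau>)
      = (if even p = even q then insert (p, q) (inversions 2 n ?\<tau>) else inversions 2 n ?\<tau>)"
    unfolding inversions_2 ins by auto
  have "(p, q) \<notin> inversions 2 n ?\<tau>" using pq(3) by (simp add: inversions_2)
  then have card2: "card (inversions 2 n (transpose i (i + 1) \<circ> ?\<tau>))
      = (if ?x ! (i - 1) \<noteq> ?x ! i then Suc (card (inversions 2 n ?\<tau>))
         else card (inversions 2 n ?\<tau>))"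
    unfolding inv2 using differ by simp
  define \<alpha>' where "\<alpha>' = (if ?x ! (i - 1) = L1 \<and> ?x ! i = L1 then Suc \<alpha> else \<alpha>)"
  have "foldr c_op (i # is) (vec (replicate n L1))
      = scale (var_a ^ \<alpha> * var_b ^ card (inversions 2 n ?\<tau>) * weight (?x ! (i - 1)) (?x ! i))
          (vec (s_act i ?x))"
    by (simp add: \<alpha> c_op_scale_vec)
  also have "var_a ^ \<alpha> * var_b ^ card (inversions 2 n ?\<tau>) * weight (?x ! (i - 1)) (?x ! i)
      = var_a ^ \<alpha>' * var_b ^ card (inversions 2 n (transpose i (i + 1) \<circ> ?\<tau>))"
    unfolding card2
    by (cases "?x ! (i - 1)"; cases "?x ! i") (simp_all add: weight_def \<alpha>'_def)
  finally have 1: "foldr c_op (i # is) (vec (replicate n L1))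
      = scale (var_a ^ \<alpha>' * var_b ^ card (inversions 2 n (transpose i (i + 1) \<circ> ?\<tau>)))
          (vec (s_act i ?x))" .
  have 2: "4 * \<alpha>' + 2 * card (inversions 2 n (transpose i (i + 1) \<circ> ?\<tau>))
      = 2 * length (i # is) + count_list (s_act i ?x) L2"
    unfolding card2 using rel count
    by (cases "?x ! (i - 1)"; cases "?x ! i") (simp_all add: \<alpha>'_def)
  show ?case unfolding step using 1 2 by (intro exI[of _ \<alpha>']) (simp add: comp_def)
qed

lemma Phi_stabilizer:
  assumes "\<sigma> \<in> G n"
  shows "\<exists>\<alpha>. Phi n \<sigma> (vec (replicate n L1))
             = scale (var_a ^ \<alpha> * var_b ^ tl_len n \<sigma>) (vec (replicate n L1))
           \<and> sl n \<sigma> = 2 * \<alpha> + tl_len n \<sigma>"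
proof -
  have perm: "\<sigma> permutes {1..n}" and fixed: "act n \<sigma> (replicate n L1) = replicate n L1"
    using assms by (auto simp: G_def)
  define js where "js = (SOME is. is_reduced n \<sigma> is)"
  have "\<exists>is. is_reduced n \<sigma> is"
    using expr_of_length_card_inversions[of 1 n \<sigma>] perm
    by (simp add: is_reduced_def is_s_expr_def simple_transp_eq sl_eq_card_inversions[OF perm]
        residue_perm_def)
  then have red: "is_reduced n \<sigma> js" unfolding js_def by (rule someI_ex)
  then have e: "is_s_expr n \<sigma> js" and len: "length js = card (inversions 1 n \<sigma>)"
    by (auto simp: is_reduced_def sl_eq_card_inversions[OF perm])
  have f: "foldr s_act js (replicate n L1) = replicate n L1"
    using act_eq[OF e, of "replicate n L1"] fixed by (simp add: words_def)
  have c: "count_list (replicate n L1) L2 = 0" by (induction n) auto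
  show ?thesis
    using foldr_c_op_reduced[of js n] e len f c
      tl_len_eq_card_inversions[OF assms] sl_eq_card_inversions[OF perm]
    by (auto simp: is_s_expr_def Phi_def js_def[symmetric])
qed

section \<open>The coefficients\<close>

lemma finite_G: "finite (G n)"
  by (rule finite_subset[OF _ finite_permutations[of "{1..n}"]]) (auto simp: G_def)

lemma var_monomial: "var_a ^ i * var_b ^ j = monom (monom 1 i) j"
proof -
  have "var_a ^ i * var_b ^ j = monom (monom 1 1) 0 ^ i * monom 1 1 ^ j"
    by (simp_all add: var_a_def var_b_def monom_altdef)
  also have "\<dots> = monom (monom 1 i) j"
    by (simp add: monom_power mult_monom)
  finally show ?thesis .
qed

lemma Ftilde_eq:
  "Ftilde n = (\<Sum>\<sigma>\<in>G n. monom (monom 1 ((sl n \<sigma> - tl_len n \<sigma>) div 2)) (tl_len n \<sigma>))"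
    (is "_ = ?F")
proof -
  have "Phi n \<sigma> (vec (replicate n L1))
      = scale (monom (monom 1 ((sl n \<sigma> - tl_len n \<sigma>) div 2)) (tl_len n \<sigma>)) (vec (replicate n L1))"
    if "\<sigma> \<in> G n" for \<sigma>
    using Phi_stabilizer[OF that] by (auto simp: var_monomial)
  then have "(\<Sum>\<sigma>\<in>G n. Phi n \<sigma> (vec (replicate n L1))) = scale ?F (vec (replicate n L1))"
    by (simp add: scale_sum_left)
  then show ?thesis by (auto simp: Ftilde_def scale_vec_inject)
qed

text \<open>
  Counting the terms of a sum of monomials by their exponents; the sum over all \<open>i\<close> is finite
  because only the values of \<open>f\<close> contribute.
\<close>

lemma sum_monom_eq_Sum_any_card:
  assumes "finite A"
  shows "(\<Sum>w\<in>A. monom (1 :: int) (f w)) = Sum_any (\<lambda>i. monom (int (card {w \<in> A. f w = i})) i)"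
proof -
  have "(\<Sum>w\<in>A. monom (1 :: int) (f w)) = (\<Sum>i\<in>f ` A. \<Sum>w | w \<in> A \<and> f w = i. monom 1 (f w))"
    using assms by (intro sum.group[symmetric]) auto
  also have "\<dots> = (\<Sum>i\<in>f ` A. monom (int (card {w \<in> A. f w = i})) i)"
  proof (rule sum.cong[OF refl])
    fix i
    have "(\<Sum>w | w \<in> A \<and> f w = i. monom (1 :: int) (f w)) = (\<Sum>w | w \<in> A \<and> f w = i. monom 1 i)"
      by (intro sum.cong) auto
    then show "(\<Sum>w | w \<in> A \<and> f w = i. monom (1 :: int) (f w))
        = monom (int (card {w \<in> A. f w = i})) i"
      by (simp add: of_nat_monom mult_monom)
  qed
  also have "\<dots> = Sum_any (\<lambda>i. monom (int (card {w \<in> A. f w = i})) i)"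
    using assms by (intro Sum_any.expand_superset[symmetric]) (auto intro!: imageI)
  finally show ?thesis .
qed

theorem proposition3p1:
  fixes n k :: nat
  assumes "n \<ge> 1"
  shows "Ftilde_k n k =
           (\<Sum>w | w \<in> G n \<and> tl_len n w = k.
              monom 1 (nat (int k - (3 * int k - int (sl n w)) div 2)))
       \<and> (\<Sum>w | w \<in> G n \<and> tl_len n w = k.
              monom 1 (nat (int k - (3 * int k - int (sl n w)) div 2))) =
         Sum_any (\<lambda>i. monom (int (E n k (2 * i + k))) i)"
proof
  let ?W = "{w. w \<in> G n \<and> tl_len n w = k}"
  let ?f = "\<lambda>w. nat (int k - (3 * int k - int (sl n w)) div 2)"
  have sl: "sl n w = 2 * ?f w + k" if "w \<in> ?W" for w
    using Phi_stabilizer[of w n] that by auto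
  have "Ftilde_k n k
      = (\<Sum>w\<in>G n. if tl_len n w = k then monom 1 ((sl n w - tl_len n w) div 2) else 0)"
    by (simp add: Ftilde_k_def Ftilde_eq coeff_sum)
  also have "\<dots> = (\<Sum>w\<in>?W. monom 1 ((sl n w - tl_len n w) div 2))"
    by (rule sum.inter_filter[OF finite_G, symmetric])
  also have "\<dots> = (\<Sum>w\<in>?W. monom 1 (?f w))"
  proof (rule sum.cong[OF refl])
    fix w assume w: "w \<in> ?W"
    then have "(sl n w - tl_len n w) div 2 = ?f w" using sl[OF w] by simp
    then show "monom (1 :: int) ((sl n w - tl_len n w) div 2) = monom 1 (?f w)" by simp
  qed
  finally show "Ftilde_k n k = (\<Sum>w\<in>?W. monom 1 (?f w))" .
  have "card {w \<in> ?W. ?f w = i} = E n k (2 * i + k)" for i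
  proof -
    have "{w \<in> ?W. ?f w = i} = {w \<in> G n. tl_len n w = k \<and> sl n w = 2 * i + k}"
    proof (intro set_eqI)
      fix w
      show "w \<in> {w \<in> ?W. ?f w = i} \<longleftrightarrow> w \<in> {w \<in> G n. tl_len n w = k \<and> sl n w = 2 * i + k}"
        using sl[of w] by (cases "w \<in> ?W") auto
    qed
    then show ?thesis by (simp add: E_def)
  qed
  then show "(\<Sum>w\<in>?W. monom 1 (?f w)) = Sum_any (\<lambda>i. monom (int (E n k (2 * i + k))) i)"
    using sum_monom_eq_Sum_any_card[of ?W ?f] finite_G[of n] by simp
qed

end
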